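(* Let $\mathfrak{g}_+,\mathfrak{g}_-$ be real finite-dimensional Lie algebras of the same dimension, endowed with pseudo-Riemannian metrics $h_+,h_-$ of the same signature, and let $Q\colon(\mathfrak{g}_+,h_+)\to(\mathfrak{g}_-,h_-)$ be a linear isometry. Let $\varphi\colon\mathfrak{g}_-\to\mathrm{End}(\mathfrak{g}_+)$ and $\rho\colon\mathfrak{g}_+\to\mathrm{End}(\mathfrak{g}_-)$ be Lie algebra representations satisfying the bicross compatibility conditions. Then the Born structure on the bicross product $\mathfrak{g}_+\bowtie_\varphi^\rho\mathfrak{g}_-$ associated with the data $(\mathfrak{g}_\pm,h_\pm,Q,\varphi,\rho)$ is integrable if and only if all of the following hold: 1. $\varphi(X_-)^a=Q^{-1}\nabla^-_{X_-}Q$ for all $X_-\in\mathfrak{g}_-$; 2. $\varphi(QX_+)^sY_+=\varphi(QY_+)^sX_+$ for all $X_+,Y_+\in\mathfrak{g}_+$; 3. $\rho(X_+)^a=Q\nabla^+_{X_+}Q^{-1}$ for all $X_+\in\mathfrak{g}_+$; 4. $\rho(X_+)^sQY_+=\rho(Y_+)^sQX_+$ for all $X_+,Y_+\in\mathfrak{g}_+$.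
   Context: All Lie algebras are real and finite-dimensional. A pseudo-Riemannian metric on a Lie algebra is a non-degenerate symmetric bilinear form of arbitrary signature. Born structures. For non-degenerate bilinear forms $a,b$ on a vector space, the recursion operator from $a$ to $b$ is the unique invertible endomorphism $A$ with $a(A\cdot,\cdot)=b(\cdot,\cdot)$. A Born structure on a Lie algebra $\mathfrak{g}$ is a triple $(g,h,\omega)$ of two pseudo-Riemannian metrics $g,h$ and a non-degenerate two-form $\omega$ such that the recursion operators $A$ from $g$ to $\omega$, $B$ from $g$ to $h$ and $-J$ from $\omega$ to $h$ satisfy $A^2=B^2=-J^2=\mathrm{Id}$. It is integrable if $\omega$ is closed under the Chevalley–Eilenberg differential, the Nijenhuis tensor of $J$ vanishes, and the $\pm1$-eigenspaces of $A$ are subalgebras. A Born structure is equivalently encoded as $(h,J,\mathfrak{g}_\pm)$, where $J^2=-\mathrm{Id}$, $h(J\cdot,J\cdot)=h$, and $\mathfrak{g}=\mathfrak{g}_+\oplus\mathfrak{g}_-$ is an $h$-orthogonal splitting whose summands (the $\pm1$-eigenspaces of $A$) are interchanged by $J$; then $\omega=h(J\cdot,\cdot)$ and $g=\omega(A\cdot,\cdot)$. Bicross product. Representations $\varphi\colon\mathfrak{g}_-\to\mathrm{End}(\mathfrak{g}_+)$, $\rho\colon\mathfrak{g}_+\to\mathrm{End}(\mathfrak{g}_-)$ satisfy the bicross compatibility conditions if for all $X_+,Y_+\in\mathfrak{g}_+$, $X_-,Y_-\in\mathfrak{g}_-$: $$\varphi(X_-)[X_+,Y_+]_+-[\varphi(X_-)X_+,Y_+]_+-[X_+,\varphi(X_-)Y_+]_++\varphi(\rho(X_+)X_-)Y_+-\varphi(\rho(Y_+)X_-)X_+=0,$$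 $$\rho(X_+)[X_-,Y_-]_--[\rho(X_+)X_-,Y_-]_--[X_-,\rho(X_+)Y_-]_-+\rho(\varphi(X_-)X_+)Y_--\rho(\varphi(Y_-)X_+)X_-=0,$$ where $[\cdot,\cdot]_\pm$ are the brackets of $\mathfrak{g}_\pm$. Then $\mathfrak{g}_+\bowtie_\varphi^\rho\mathfrak{g}_-$ is the Lie algebra on the vector space $\mathfrak{g}_+\oplus\mathfrak{g}_-$ with bracket $$[X_++X_-,Y_++Y_-]=[X_+,Y_+]_++\varphi(X_-)Y_+-\varphi(Y_-)X_++[X_-,Y_-]_-+\rho(X_+)Y_--\rho(Y_+)X_-.$$ Associated Born structure. The Born structure associated with the data $(\mathfrak{g}_\pm,h_\pm,Q,\varphi,\rho)$ is the one on $\mathfrak{g}_+\bowtie_\varphi^\rho\mathfrak{g}_-$ encoded by $(h,J,\mathfrak{g}_\pm)$ with $h=h_+\oplus h_-$ and $J=\begin{pmatrix}0&-Q^{-1}\\Q&0\end{pmatrix}$ in the splitting $\mathfrak{g}_+\oplus\mathfrak{g}_-$. Notation. $\nabla^\pm$ is the Levi-Civita connection of $(\mathfrak{g}_\pm,h_\pm)$ (so $\nabla^\pm_X\in\mathrm{End}(\mathfrak{g}_\pm)$). For an endomorphism $f$ of $\mathfrak{g}_\pm$ with $h_\pm$-adjoint $f^*$, $f^s=\tfrac12(f+f^* )$ and $f^a=\tfrac12(f-f^* )$. *)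

theory Defs
  imports "HOL-Analysis.Analysis"
begin

section \<open>Metrics and Lie algebras\<close>

text \<open>
  The vector spaces are types of class \<^class>\<open>real_vector\<close> with a finite spanning set. The class
  \<^class>\<open>euclidean_space\<close> is avoided: it distinguishes a positive definite inner product and excludes
  the zero space.
\<close>

definition finite_dimensional :: "'a::real_vector itself \<Rightarrow> bool" where
  "finite_dimensional _ \<longleftrightarrow> (\<exists>B::'a set. finite B \<and> span B = UNIV)"

definition nondegenerate :: "('a::real_vector \<Rightarrow> 'a \<Rightarrow> real) \<Rightarrow> bool" where
  "nondegenerate b \<longleftrightarrow>
     (\<forall>x. (\<forall>y. b x y = 0) \<longrightarrow> x = 0) \<and> (\<forall>y. (\<forall>x. b x y = 0) \<longrightarrow> y = 0)"

definition pseudo_metric :: "('a::real_vector \<Rightarrow> 'a \<Rightarrow> real) \<Rightarrow> bool" where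
  "pseudo_metric h \<longleftrightarrow> bilinear h \<and> (\<forall>x y. h x y = h y x) \<and> nondegenerate h"

definition two_form :: "('a::real_vector \<Rightarrow> 'a \<Rightarrow> real) \<Rightarrow> bool" where
  "two_form \<omega> \<longleftrightarrow> bilinear \<omega> \<and> (\<forall>x y. \<omega> x y = - \<omega> y x)"

text \<open>The signature \<open>(p, q)\<close>, through maximal definite subspaces (Sylvester's law of inertia).\<close>

definition signature :: "('a::real_vector \<Rightarrow> 'a \<Rightarrow> real) \<Rightarrow> nat \<times> nat" where
  "signature h =
     (Max {dim S |S. subspace S \<and> (\<forall>x\<in>S. x \<noteq> 0 \<longrightarrow> h x x > 0)},
      Max {dim S |S. subspace S \<and> (\<forall>x\<in>S. x \<noteq> 0 \<longrightarrow> h x x < 0)})"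

definition linear_isometry ::
  "('a::real_vector \<Rightarrow> 'a \<Rightarrow> real) \<Rightarrow> ('b::real_vector \<Rightarrow> 'b \<Rightarrow> real) \<Rightarrow> ('a \<Rightarrow> 'b) \<Rightarrow> bool" where
  "linear_isometry h k Q \<longleftrightarrow> linear Q \<and> bij Q \<and> (\<forall>x y. k (Q x) (Q y) = h x y)"

definition lie_algebra :: "('a::real_vector \<Rightarrow> 'a \<Rightarrow> 'a) \<Rightarrow> bool" where
  "lie_algebra br \<longleftrightarrow>
     finite_dimensional TYPE('a) \<and> bilinear br \<and> (\<forall>x. br x x = 0) \<and>
     (\<forall>x y z. br x (br y z) + br y (br z x) + br z (br x y) = 0)"

definition lie_subalgebra :: "('a::real_vector \<Rightarrow> 'a \<Rightarrow> 'a) \<Rightarrow> 'a set \<Rightarrow> bool" where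
  "lie_subalgebra br S \<longleftrightarrow> subspace S \<and> (\<forall>x\<in>S. \<forall>y\<in>S. br x y \<in> S)"

text \<open>\<^const>\<open>bilinear\<close> says that \<open>\<phi> x\<close> is an endomorphism depending linearly on \<open>x\<close>.\<close>

definition lie_representation ::
  "('a::real_vector \<Rightarrow> 'a \<Rightarrow> 'a) \<Rightarrow> ('a \<Rightarrow> 'b::real_vector \<Rightarrow> 'b) \<Rightarrow> bool" where
  "lie_representation br \<phi> \<longleftrightarrow>
     bilinear \<phi> \<and> (\<forall>x y v. \<phi> (br x y) v = \<phi> x (\<phi> y v) - \<phi> y (\<phi> x v))"

definition metric_adjoint :: "('a::real_vector \<Rightarrow> 'a \<Rightarrow> real) \<Rightarrow> ('a \<Rightarrow> 'a) \<Rightarrow> ('a \<Rightarrow> 'a)" where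
  "metric_adjoint h f = (THE f'. linear f' \<and> (\<forall>x y. h (f x) y = h x (f' y)))"

definition sym_part :: "('a::real_vector \<Rightarrow> 'a \<Rightarrow> real) \<Rightarrow> ('a \<Rightarrow> 'a) \<Rightarrow> ('a \<Rightarrow> 'a)" where
  "sym_part h f = (\<lambda>x. (1/2) *\<^sub>R (f x + metric_adjoint h f x))"

definition skew_part :: "('a::real_vector \<Rightarrow> 'a \<Rightarrow> real) \<Rightarrow> ('a \<Rightarrow> 'a) \<Rightarrow> ('a \<Rightarrow> 'a)" where
  "skew_part h f = (\<lambda>x. (1/2) *\<^sub>R (f x - metric_adjoint h f x))"

definition is_levi_civita ::
  "('a::real_vector \<Rightarrow> 'a \<Rightarrow> 'a) \<Rightarrow> ('a \<Rightarrow> 'a \<Rightarrow> real) \<Rightarrow> ('a \<Rightarrow> 'a \<Rightarrow> 'a) \<Rightarrow> bool" where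
  "is_levi_civita br h D \<longleftrightarrow>
     bilinear D \<and>
     (\<forall>x y. D x y - D y x = br x y) \<and>
     (\<forall>x y z. h (D x y) z + h y (D x z) = 0)"

definition levi_civita ::
  "('a::real_vector \<Rightarrow> 'a \<Rightarrow> 'a) \<Rightarrow> ('a \<Rightarrow> 'a \<Rightarrow> real) \<Rightarrow> ('a \<Rightarrow> 'a \<Rightarrow> 'a)" where
  "levi_civita br h = (THE D. is_levi_civita br h D)"


section \<open>Born structures\<close>

definition is_recursion_op ::
  "('a::real_vector \<Rightarrow> 'a \<Rightarrow> real) \<Rightarrow> ('a \<Rightarrow> 'a \<Rightarrow> real) \<Rightarrow> ('a \<Rightarrow> 'a) \<Rightarrow> bool" where
  "is_recursion_op a b A \<longleftrightarrow> linear A \<and> bij A \<and> (\<forall>x y. a (A x) y = b x y)"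

definition recursion_op ::
  "('a::real_vector \<Rightarrow> 'a \<Rightarrow> real) \<Rightarrow> ('a \<Rightarrow> 'a \<Rightarrow> real) \<Rightarrow> ('a \<Rightarrow> 'a)" where
  "recursion_op a b = (THE A. is_recursion_op a b A)"

type_synonym 'a born_triple =
  "('a \<Rightarrow> 'a \<Rightarrow> real) \<times> ('a \<Rightarrow> 'a \<Rightarrow> real) \<times> ('a \<Rightarrow> 'a \<Rightarrow> real)"

fun born_A :: "'a::real_vector born_triple \<Rightarrow> 'a \<Rightarrow> 'a" where
  "born_A (g, h, \<omega>) = recursion_op g \<omega>"

fun born_B :: "'a::real_vector born_triple \<Rightarrow> 'a \<Rightarrow> 'a" where
  "born_B (g, h, \<omega>) = recursion_op g h"

text \<open>It is \<open>-J\<close>, not \<open>J\<close>, that is the recursion operator from \<open>\<omega>\<close> to \<open>h\<close>.\<close>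

fun born_J :: "'a::real_vector born_triple \<Rightarrow> 'a \<Rightarrow> 'a" where
  "born_J (g, h, \<omega>) = (\<lambda>x. - recursion_op \<omega> h x)"

fun born_structure :: "('a::real_vector \<Rightarrow> 'a \<Rightarrow> 'a) \<Rightarrow> 'a born_triple \<Rightarrow> bool" where
  "born_structure br (g, h, \<omega>) \<longleftrightarrow>
     lie_algebra br \<and> pseudo_metric g \<and> pseudo_metric h \<and> two_form \<omega> \<and> nondegenerate \<omega> \<and>
     (\<forall>x. born_A (g, h, \<omega>) (born_A (g, h, \<omega>) x) = x) \<and>
     (\<forall>x. born_B (g, h, \<omega>) (born_B (g, h, \<omega>) x) = x) \<and>
     (\<forall>x. born_J (g, h, \<omega>) (born_J (g, h, \<omega>) x) = - x)"

text \<open>The Chevalley--Eilenberg differential of a two-form, with trivial coefficients.\<close>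

definition ce_differential ::
  "('a::real_vector \<Rightarrow> 'a \<Rightarrow> 'a) \<Rightarrow> ('a \<Rightarrow> 'a \<Rightarrow> real) \<Rightarrow> 'a \<Rightarrow> 'a \<Rightarrow> 'a \<Rightarrow> real" where
  "ce_differential br \<omega> x y z = - \<omega> (br x y) z + \<omega> (br x z) y - \<omega> (br y z) x"

definition nijenhuis ::
  "('a::real_vector \<Rightarrow> 'a \<Rightarrow> 'a) \<Rightarrow> ('a \<Rightarrow> 'a) \<Rightarrow> 'a \<Rightarrow> 'a \<Rightarrow> 'a" where
  "nijenhuis br J x y = br (J x) (J y) - J (br (J x) y) - J (br x (J y)) + J (J (br x y))"

fun integrable_born :: "('a::real_vector \<Rightarrow> 'a \<Rightarrow> 'a) \<Rightarrow> 'a born_triple \<Rightarrow> bool" where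
  "integrable_born br (g, h, \<omega>) \<longleftrightarrow>
     born_structure br (g, h, \<omega>) \<and>
     (\<forall>x y z. ce_differential br \<omega> x y z = 0) \<and>
     (\<forall>x y. nijenhuis br (born_J (g, h, \<omega>)) x y = 0) \<and>
     lie_subalgebra br {x. born_A (g, h, \<omega>) x = x} \<and>
     lie_subalgebra br {x. born_A (g, h, \<omega>) x = - x}"

text \<open>
  The Born structure encoded by \<open>h\<close>, \<open>J\<close> and a splitting; the splitting is given by the involution
  \<open>A\<close> having the summands as its eigenspaces for \<open>1\<close> and \<open>-1\<close>.
\<close>

definition born_of_encoding ::
  "('a::real_vector \<Rightarrow> 'a \<Rightarrow> real) \<Rightarrow> ('a \<Rightarrow> 'a) \<Rightarrow> ('a \<Rightarrow> 'a) \<Rightarrow> 'a born_triple" where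
  "born_of_encoding h J A =
     (let \<omega> = (\<lambda>x y. h (J x) y); g = (\<lambda>x y. \<omega> (A x) y) in (g, h, \<omega>))"


section \<open>Bicross products\<close>

text \<open>\<open>brp\<close>, \<open>hp\<close> and \<open>brm\<close>, \<open>hm\<close> are the brackets and metrics on the plus and minus summands.\<close>

definition bicross_compatible ::
  "('p::real_vector \<Rightarrow> 'p \<Rightarrow> 'p) \<Rightarrow> ('m::real_vector \<Rightarrow> 'm \<Rightarrow> 'm) \<Rightarrow>
   ('m \<Rightarrow> 'p \<Rightarrow> 'p) \<Rightarrow> ('p \<Rightarrow> 'm \<Rightarrow> 'm) \<Rightarrow> bool" where
  "bicross_compatible brp brm \<phi> \<rho> \<longleftrightarrow>
     (\<forall>Xm Xp Yp. \<phi> Xm (brp Xp Yp) - brp (\<phi> Xm Xp) Yp - brp Xp (\<phi> Xm Yp)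
        + \<phi> (\<rho> Xp Xm) Yp - \<phi> (\<rho> Yp Xm) Xp = 0) \<and>
     (\<forall>Xp Xm Ym. \<rho> Xp (brm Xm Ym) - brm (\<rho> Xp Xm) Ym - brm Xm (\<rho> Xp Ym)
        + \<rho> (\<phi> Xm Xp) Ym - \<rho> (\<phi> Ym Xp) Xm = 0)"

fun bicross_bracket ::
  "('p::real_vector \<Rightarrow> 'p \<Rightarrow> 'p) \<Rightarrow> ('m::real_vector \<Rightarrow> 'm \<Rightarrow> 'm) \<Rightarrow>
   ('m \<Rightarrow> 'p \<Rightarrow> 'p) \<Rightarrow> ('p \<Rightarrow> 'm \<Rightarrow> 'm) \<Rightarrow> 'p \<times> 'm \<Rightarrow> 'p \<times> 'm \<Rightarrow> 'p \<times> 'm" where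
  "bicross_bracket brp brm \<phi> \<rho> (Xp, Xm) (Yp, Ym) =
     (brp Xp Yp + \<phi> Xm Yp - \<phi> Ym Xp, brm Xm Ym + \<rho> Xp Ym - \<rho> Yp Xm)"

fun sum_form ::
  "('p \<Rightarrow> 'p \<Rightarrow> real) \<Rightarrow> ('m \<Rightarrow> 'm \<Rightarrow> real) \<Rightarrow> 'p \<times> 'm \<Rightarrow> 'p \<times> 'm \<Rightarrow> real" where
  "sum_form hp hm (Xp, Xm) (Yp, Ym) = hp Xp Yp + hm Xm Ym"

fun swap_J :: "('p::real_vector \<Rightarrow> 'm::real_vector) \<Rightarrow> 'p \<times> 'm \<Rightarrow> 'p \<times> 'm" where
  "swap_J Q (Xp, Xm) = (- inv Q Xm, Q Xp)"

fun split_A :: "'p::real_vector \<times> 'm::real_vector \<Rightarrow> 'p \<times> 'm" where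
  "split_A (Xp, Xm) = (Xp, - Xm)"

definition associated_born ::
  "('p::real_vector \<Rightarrow> 'p \<Rightarrow> real) \<Rightarrow> ('m::real_vector \<Rightarrow> 'm \<Rightarrow> real) \<Rightarrow> ('p \<Rightarrow> 'm) \<Rightarrow>
   ('p \<times> 'm) born_triple" where
  "associated_born hp hm Q = born_of_encoding (sum_form hp hm) (swap_J Q) split_A"


section \<open>Well-definedness\<close>

text \<open>
  Adjoints and Levi-Civita connections exist and are unique, so the definite descriptions above
  denote; the bicross product is a Lie algebra; and the associated triple is a Born structure whose
  operators \<open>A\<close> and \<open>J\<close> are the ones it was built from.
\<close>

lemma nondegenerate_eqI:
  assumes "bilinear a" "nondegenerate a" "\<And>y. a x y = a x' y" shows "x = x'"
proof -
  have "\<forall>y. a (x - x') y = 0" using assms by (simp add: bilinear_lsub)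
  then have "x - x' = 0" using assms(2) unfolding nondegenerate_def by blast
  then show ?thesis by simp
qed

lemma recursion_op_eqI:
  assumes "bilinear a" "nondegenerate a" "is_recursion_op a b A"
  shows "recursion_op a b = A"
  unfolding recursion_op_def
proof (rule the_equality, fact assms(3))
  fix A' assume A': "is_recursion_op a b A'"
  show "A' = A"
  proof
    fix x show "A' x = A x"
      using nondegenerate_eqI[OF assms(1,2), of "A' x" "A x"] A' assms(3)
      unfolding is_recursion_op_def by simp
  qed
qed

lemma nondegenerate_represent:
  fixes h :: "'a::real_vector \<Rightarrow> 'a \<Rightarrow> real"
  assumes fd: "finite_dimensional TYPE('a)" and b: "bilinear h" and nd: "nondegenerate h"
    and lf: "linear f"
  shows "\<exists>v. \<forall>y. h v y = f y"
proof -
  obtain S :: "'a set" where S: "finite S" "span S = UNIV"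
    using fd unfolding finite_dimensional_def by blast
  obtain B where B: "B \<subseteq> S" "independent B" "S \<subseteq> span B"
    using real_vector.maximal_independent_subset[of S] by blast
  have fB: "finite B" using B S finite_subset by blast
  have sB: "span B = UNIV"
    using S B by (metis real_vector.span_mono real_vector.span_span top.extremum_uniqueI)
  interpret V: finite_dimensional_vector_space "scaleR :: real \<Rightarrow> 'a \<Rightarrow> 'a" B
    rewrites "module.span (*\<^sub>R) = span" and "module.dependent (*\<^sub>R) = dependent"
    by (unfold_locales) (use fB B sB in \<open>auto simp: span_raw_def dependent_raw_def\<close>)
  define T where "T v = (\<Sum>b\<in>B. h v b *\<^sub>R b)" for v
  have linT: "linear T"
    unfolding T_def by (rule linearI)
      (simp_all add: bilinear_ladd[OF b] bilinear_lmul[OF b] scaleR_left_distrib sum.distrib scaleR_sum_right)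
  have indep: "u c = w c" if "(\<Sum>b\<in>B. u b *\<^sub>R b) = (\<Sum>b\<in>B. w b *\<^sub>R b)" "c \<in> B" for u w c
  proof -
    have "(\<Sum>b\<in>B. (u b - w b) *\<^sub>R b) = 0" using that by (simp add: scaleR_left_diff_distrib sum_subtractf)
    then have "u c - w c = 0"
      using independentD[OF B(2) fB order_refl, of "\<lambda>b. u b - w b" c] that(2) by simp
    then show ?thesis by simp
  qed
  have ext: "g1 = g2" if "linear g1" "linear g2" "\<And>b. b \<in> B \<Longrightarrow> g1 b = g2 b" for g1 g2 :: "'a \<Rightarrow> real"
    using that sB by (metis (no_types) linear_eq_on UNIV_I ext)
  have inj: "inj T"
  proof (rule injI)
    fix v w assume "T v = T w"
    then have "h v b = h w b" if "b \<in> B" for b using indep[of "h v" "h w" b] that unfolding T_def by simp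
    then have "h v = h w" using b by (intro ext) (auto simp: bilinear_def)
    then show "v = w" using nondegenerate_eqI[OF b nd] by metis
  qed
  have "surj T" using V.linear_inj_imp_surj[of T] linT inj unfolding linear_def
    by (auto simp: linear_iff linear_def)
  then obtain v where "T v = (\<Sum>b\<in>B. f b *\<^sub>R b)" by (metis surjD)
  then have "h v b = f b" if "b \<in> B" for b using indep[of "h v" f b] that unfolding T_def by simp
  then have "h v = f" using b lf by (intro ext) (auto simp: bilinear_def)
  then show ?thesis by auto
qed

lemma metric_adjoint_ex1:
  fixes h :: "'a::real_vector \<Rightarrow> 'a \<Rightarrow> real"
  assumes fd: "finite_dimensional TYPE('a)" and h: "pseudo_metric h" and lf: "linear f"
  shows "\<exists>!f'. linear f' \<and> (\<forall>x y. h (f x) y = h x (f' y))"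
proof -
  have b: "bilinear h" and nd: "nondegenerate h" and sy: "\<And>x y. h x y = h y x"
    using h unfolding pseudo_metric_def by auto
  have "\<exists>v. \<forall>x. h v x = h (f x) y" for y
    by (rule nondegenerate_represent[OF fd b nd])
      (rule linearI, simp_all add: linear_add[OF lf] linear_scale[OF lf] bilinear_ladd[OF b] bilinear_lmul[OF b])
  then obtain f' where f': "\<And>x y. h (f' y) x = h (f x) y" by metis
  have "linear f'"
    by (rule linearI; rule nondegenerate_eqI[OF b nd])
      (simp_all add: f' bilinear_ladd[OF b] bilinear_lmul[OF b] bilinear_radd[OF b] bilinear_rmul[OF b])
  moreover have "\<forall>x y. h (f x) y = h x (f' y)" using f' sy by metis
  ultimately show ?thesis
  proof (intro ex1I[of _ f'] conjI, blast, blast)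
    fix k assume k: "linear k \<and> (\<forall>x y. h (f x) y = h x (k y))"
    show "k = f'"
    proof
      fix y show "k y = f' y"
        by (rule nondegenerate_eqI[OF b nd]) (metis k f' sy)
    qed
  qed
qed

lemma levi_civita_ex1:
  fixes br :: "'a::real_vector \<Rightarrow> 'a \<Rightarrow> 'a"
  assumes L: "lie_algebra br" and h: "pseudo_metric h"
  shows "\<exists>!D. is_levi_civita br h D"
proof -
  have b: "bilinear h" and nd: "nondegenerate h" and sy: "\<And>x y. h x y = h y x"
    using h unfolding pseudo_metric_def by auto
  have fd: "finite_dimensional TYPE('a)" and bb: "bilinear br" and alt: "\<And>x. br x x = 0"
    using L unfolding lie_algebra_def by auto
  have skew: "br x y = - br y x" for x y
    using alt[of "x + y"] unfolding bilinear_ladd[OF bb] bilinear_radd[OF bb] by (simp add: alt eq_neg_iff_add_eq_0 add.commute)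
  note bs = bilinear_ladd[OF b] bilinear_lmul[OF b] bilinear_radd[OF b] bilinear_rmul[OF b]
    bilinear_ladd[OF bb] bilinear_lmul[OF bb] bilinear_radd[OF bb] bilinear_rmul[OF bb]
  define K where "K x y z = (h (br x y) z - h (br y z) x + h (br z x) y) / 2" for x y z
  have "\<exists>v. \<forall>z. h v z = K x y z" for x y
    by (rule nondegenerate_represent[OF fd b nd])
      (rule linearI, simp_all add: K_def bs field_simps)
  then obtain D where D: "\<And>x y z. h (D x y) z = K x y z" by metis
  have "bilinear D"
    unfolding bilinear_def
    by (intro conjI allI; rule linearI; rule nondegenerate_eqI[OF b nd])
      (simp_all add: D bs K_def field_simps)
  moreover have "D x y - D y x = br x y" for x y
  proof (rule nondegenerate_eqI[OF b nd])
    fix z 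
    have "br y x = - br x y" "br x z = - br z x" "br z y = - br y z" by (rule skew)+
    then show "h (D x y - D y x) z = h (br x y) z"
      by (simp add: bilinear_lsub[OF b] D K_def bilinear_lneg[OF b] field_simps)
  qed
  moreover have "h (D x y) z + h y (D x z) = 0" for x y z
  proof -
    have "br y x = - br x y" "br x z = - br z x" "br z y = - br y z" by (rule skew)+
    then show ?thesis by (subst sy[of y "D x z"]) (simp add: D K_def bilinear_lneg[OF b] field_simps)
  qed
  ultimately have LD: "is_levi_civita br h D" unfolding is_levi_civita_def by blast
  have kos: "2 * h (E x y) z = h (br x y) z - h (br y z) x + h (br z x) y"
    if "is_levi_civita br h E" for E x y z
  proof -
    have t: "br u v = E u v - E v u" for u v
      using that unfolding is_levi_civita_def by simp
    have m: "h (E u v) w = - h (E u w) v" for u v w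
    proof -
      have "h (E u v) w + h v (E u w) = 0" using that unfolding is_levi_civita_def by blast
      then show ?thesis unfolding sy[of v "E u w"] by linarith
    qed
    show ?thesis
      by (simp add: t bilinear_lsub[OF b]) (use m[of x y z] m[of y x z] m[of z x y] in linarith)
  qed
  show ?thesis
  proof (rule ex1I, fact LD)
    fix E assume E: "is_levi_civita br h E"
    show "E = D"
    proof (intro ext)
      fix x y show "E x y = D x y"
        by (rule nondegenerate_eqI[OF b nd]) (use kos[OF E, of x y] kos[OF LD, of x y] in \<open>metis mult_cancel_left zero_neq_numeral\<close>)
    qed
  qed
qed

lemma sum3_zeroD: "a + b + c = 0 \<Longrightarrow> a = - b - c" for a b c :: "'z::ab_group_add"
  using eq_neg_iff_add_eq_0[of a "b + c"] by (simp add: add.assoc)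

lemma lie_algebra_bicross:
  fixes brp :: "'p::real_vector \<Rightarrow> 'p \<Rightarrow> 'p" and brm :: "'m::real_vector \<Rightarrow> 'm \<Rightarrow> 'm"
  assumes P: "lie_algebra brp" and M: "lie_algebra brm"
    and F: "lie_representation brm \<phi>" and R: "lie_representation brp \<rho>"
    and C: "bicross_compatible brp brm \<phi> \<rho>"
  shows "lie_algebra (bicross_bracket brp brm \<phi> \<rho>)"
proof -
  have bp: "bilinear brp" and bm: "bilinear brm" and bf: "bilinear \<phi>" and br: "bilinear \<rho>"
    and ap: "\<And>x. brp x x = 0" and am: "\<And>x. brm x x = 0"
    and jp: "\<And>x y z. brp x (brp y z) + brp y (brp z x) + brp z (brp x y) = 0"
    and jm: "\<And>x y z. brm x (brm y z) + brm y (brm z x) + brm z (brm x y) = 0"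
    and rf: "\<And>x y v. \<phi> (brm x y) v = \<phi> x (\<phi> y v) - \<phi> y (\<phi> x v)"
    and rr: "\<And>x y v. \<rho> (brp x y) v = \<rho> x (\<rho> y v) - \<rho> y (\<rho> x v)"
    using assms unfolding lie_algebra_def lie_representation_def by auto
  have c1: "\<phi> a (brp x y) = brp (\<phi> a x) y + brp x (\<phi> a y) - \<phi> (\<rho> x a) y + \<phi> (\<rho> y a) x" for a x y
    using C unfolding bicross_compatible_def by (simp add: algebra_simps add_eq_0_iff)
  have c2: "\<rho> x (brm a c) = brm (\<rho> x a) c + brm a (\<rho> x c) - \<rho> (\<phi> a x) c + \<rho> (\<phi> c x) a" for a c x
    using C unfolding bicross_compatible_def by (simp add: algebra_simps add_eq_0_iff)
  have skp: "brp x y = - brp y x" for x y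
    using ap[of "x + y"] unfolding bilinear_ladd[OF bp] bilinear_radd[OF bp] by (simp add: ap eq_neg_iff_add_eq_0 add.commute)
  have skm: "brm x y = - brm y x" for x y
    using am[of "x + y"] unfolding bilinear_ladd[OF bm] bilinear_radd[OF bm] by (simp add: am eq_neg_iff_add_eq_0 add.commute)
  note bs = bilinear_ladd[OF bp] bilinear_radd[OF bp] bilinear_lmul[OF bp] bilinear_rmul[OF bp]
    bilinear_lsub[OF bp] bilinear_rsub[OF bp]
    bilinear_ladd[OF bm] bilinear_radd[OF bm] bilinear_lmul[OF bm] bilinear_rmul[OF bm]
    bilinear_lsub[OF bm] bilinear_rsub[OF bm]
    bilinear_ladd[OF bf] bilinear_radd[OF bf] bilinear_lmul[OF bf] bilinear_rmul[OF bf]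
    bilinear_lsub[OF bf] bilinear_rsub[OF bf]
    bilinear_ladd[OF br] bilinear_radd[OF br] bilinear_lmul[OF br] bilinear_rmul[OF br]
    bilinear_lsub[OF br] bilinear_rsub[OF br]
  have "finite_dimensional TYPE('p \<times> 'm)"
  proof -
    obtain S :: "'p set" and T :: "'m set" where S: "finite S" "span S = UNIV" "finite T" "span T = UNIV"
      using P M unfolding lie_algebra_def finite_dimensional_def by blast
    have "span (S \<times> {0} \<union> {0} \<times> T) = UNIV"
    proof -
      let ?W = "span (S \<times> {0} \<union> {0} \<times> T)"
      have l1: "linear (\<lambda>x::'p. (x, 0::'m))" and l2: "linear (\<lambda>y::'m. (0::'p, y))"
        by (auto intro!: linearI)
      have "(x, 0) \<in> ?W" for x
      proof -
        have "(\<lambda>x::'p. (x, 0::'m)) ` span S \<subseteq> ?W"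
          unfolding linear_span_image[OF l1, symmetric] by (rule real_vector.span_mono) auto
        then show ?thesis using S by auto
      qed
      moreover have "(0, y) \<in> ?W" for y
      proof -
        have "(\<lambda>y::'m. (0::'p, y)) ` span T \<subseteq> ?W"
          unfolding linear_span_image[OF l2, symmetric] by (rule real_vector.span_mono) auto
        then show ?thesis using S by auto
      qed
      ultimately have "(x, 0) + (0, y) \<in> ?W" for x y by (rule real_vector.span_add)
      then show ?thesis by auto
    qed
    moreover have "finite (S \<times> {0::'m} \<union> {0::'p} \<times> T)" using S by simp
    ultimately show ?thesis unfolding finite_dimensional_def by blast
  qed
  moreover have "bilinear (bicross_bracket brp brm \<phi> \<rho>)"
    unfolding bilinear_def
    by (intro conjI allI; rule linearI) (auto simp: bs algebra_simps)
  moreover have "bicross_bracket brp brm \<phi> \<rho> x x = 0" for x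
    by (cases x) (simp add: ap am zero_prod_def)
  moreover have "bicross_bracket brp brm \<phi> \<rho> x (bicross_bracket brp brm \<phi> \<rho> y z) +
      bicross_bracket brp brm \<phi> \<rho> y (bicross_bracket brp brm \<phi> \<rho> z x) +
      bicross_bracket brp brm \<phi> \<rho> z (bicross_bracket brp brm \<phi> \<rho> x y) = 0" for x y z
  proof -
    obtain xp xm yp ym zp zm where e: "x = (xp, xm)" "y = (yp, ym)" "z = (zp, zm)"
      by (metis surj_pair)
    have P1: "brp xp (brp yp zp) = - brp yp (brp zp xp) - brp zp (brp xp yp)"
      using jp[of xp yp zp] by (rule sum3_zeroD)
    have M1: "brm xm (brm ym zm) = - brm ym (brm zm xm) - brm zm (brm xm ym)"
      using jm[of xm ym zm] by (rule sum3_zeroD)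
    show ?thesis
      unfolding e
      apply (simp add: bs zero_prod_def rf rr c1 c2 P1 M1)
      apply (rule conjI)
      subgoal
        using skp[of xp "\<phi> ym zp"] skp[of xp "\<phi> zm yp"] skp[of yp "\<phi> xm zp"] skp[of yp "\<phi> zm xp"] skp[of zp "\<phi> xm yp"] skp[of zp "\<phi> ym xp"]
        by (simp add: algebra_simps)
      subgoal
        using skm[of xm "\<rho> yp zm"] skm[of xm "\<rho> zp ym"] skm[of ym "\<rho> xp zm"] skm[of ym "\<rho> zp xm"] skm[of zm "\<rho> xp ym"] skm[of zm "\<rho> yp xm"]
        by (simp add: algebra_simps)
      done
  qed
  ultimately show ?thesis unfolding lie_algebra_def by blast
qed

lemma associated_born_ops:
  fixes hp :: "'p::real_vector \<Rightarrow> 'p \<Rightarrow> real" and hm :: "'m::real_vector \<Rightarrow> 'm \<Rightarrow> real"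
  assumes hp: "pseudo_metric hp" and hm: "pseudo_metric hm" and Q: "linear_isometry hp hm Q"
  shows "born_A (associated_born hp hm Q) = split_A"
    and "born_B (associated_born hp hm Q) = (\<lambda>x. swap_J Q (split_A x))"
    and "born_J (associated_born hp hm Q) = swap_J Q"
    and "lie_algebra br \<Longrightarrow> born_structure br (associated_born hp hm Q)"
proof -
  have bp: "bilinear hp" and sp: "\<And>x y. hp x y = hp y x" and np: "nondegenerate hp"
    and bm: "bilinear hm" and sm: "\<And>x y. hm x y = hm y x" and nm: "nondegenerate hm"
    using hp hm unfolding pseudo_metric_def by auto
  have lQ: "linear Q" and bQ: "bij Q" and iQ: "\<And>x y. hm (Q x) (Q y) = hp x y"
    using Q unfolding linear_isometry_def by auto
  have QI[simp]: "Q (inv Q y) = y" "inv Q (Q x) = x" for x y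
    using bQ by (simp_all add: bij_is_surj surj_f_inv_f bij_is_inj)
  have lI: "linear (inv Q)"
    by (rule linearI) (metis QI linear_add[OF lQ], metis QI linear_scale[OF lQ])
  have iI: "hp (inv Q x) y = hm x (Q y)" for x y using iQ[of "inv Q x" y] by simp
  have iI2: "hp y (inv Q x) = hm (Q y) x" for x y using iQ[of y "inv Q x"] by simp
  define h where "h = sum_form hp hm"
  define w where "w = (\<lambda>x y. h (swap_J Q x) y)"
  define g where "g = (\<lambda>x y. w (split_A x) y)"
  have T: "associated_born hp hm Q = (g, h, w)"
    by (simp add: associated_born_def born_of_encoding_def g_def w_def h_def Let_def)
  note z = bilinear_lzero[OF bp] bilinear_rzero[OF bp] bilinear_lzero[OF bm] bilinear_rzero[OF bm]
  note bs = bilinear_ladd[OF bp] bilinear_radd[OF bp] bilinear_lmul[OF bp] bilinear_rmul[OF bp]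
    bilinear_lneg[OF bp] bilinear_rneg[OF bp]
    bilinear_ladd[OF bm] bilinear_radd[OF bm] bilinear_lmul[OF bm] bilinear_rmul[OF bm]
    bilinear_lneg[OF bm] bilinear_rneg[OF bm]
  have bh: "bilinear h"
    unfolding h_def bilinear_def by (intro conjI allI; rule linearI) (auto simp: bs algebra_simps)
  have sh: "h x y = h y x" for x y
    unfolding h_def by (cases x; cases y) (simp add: sp sm)
  have nh: "nondegenerate h"
  proof -
    have "x = 0" if "\<forall>y. h x y = 0" for x
    proof -
      obtain a b where x: "x = (a, b)" by (cases x)
      have "hp a u = 0" for u using that[rule_format, of "(u, 0)"] by (simp add: x h_def z)
      moreover have "hm b v = 0" for v using that[rule_format, of "(0, v)"] by (simp add: x h_def z)
      ultimately show ?thesis using np nm unfolding nondegenerate_def x by (simp add: zero_prod_def)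
    qed
    then show ?thesis unfolding nondegenerate_def using sh by metis
  qed
  have lJ: "linear (swap_J Q)"
    by (rule linearI) (auto simp: linear_add[OF lQ] linear_add[OF lI] linear_scale[OF lQ] linear_scale[OF lI])
  have lA: "linear (split_A :: 'p \<times> 'm \<Rightarrow> _)" by (rule linearI) auto
  have JJ: "swap_J Q (swap_J Q x) = - x" for x
    by (cases x) (simp add: linear_neg[OF lQ])
  have AA: "split_A (split_A x) = x" for x :: "'p \<times> 'm" by (cases x) simp
  have AJ: "split_A (swap_J Q x) = - swap_J Q (split_A x)" for x
    by (cases x) (simp add: linear_neg[OF lI])
  have bijA: "bij (split_A :: 'p \<times> 'm \<Rightarrow> _)" by (rule o_bij[of split_A]) (intro ext; simp add: AA)+
  have bijJ: "bij (swap_J Q)"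
    by (rule o_bij[of "\<lambda>x. - swap_J Q x"]) (intro ext; simp add: JJ linear_neg[OF lJ])+
  have hJ: "h (swap_J Q x) y = - h x (swap_J Q y)" for x y
    unfolding h_def by (cases x; cases y) (simp add: bs iI iI2)
  have hA: "h (split_A x) y = h x (split_A y)" for x y
    unfolding h_def by (cases x; cases y) (simp add: bs)
  have bw: "bilinear w" 
    unfolding w_def bilinear_def by (intro conjI allI; rule linearI) (simp_all only: linear_add[OF lJ] linear_scale[OF lJ] bilinear_ladd[OF bh] bilinear_radd[OF bh] bilinear_lmul[OF bh] bilinear_rmul[OF bh])
  have skw: "w x y = - w y x" for x y unfolding w_def using hJ sh by metis
  have nw: "nondegenerate w"
  proof -
    have "x = 0" if "\<forall>y. w x y = 0" for x
      using that nh JJ[of x] linear_0[OF lJ] unfolding w_def nondegenerate_def by (metis neg_equal_0_iff_equal)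
    then show ?thesis unfolding nondegenerate_def using skw by (metis neg_equal_0_iff_equal)
  qed
  have bg: "bilinear g" 
    unfolding g_def bilinear_def by (intro conjI allI; rule linearI) (simp_all only: linear_add[OF lA] linear_scale[OF lA] bilinear_ladd[OF bw] bilinear_radd[OF bw] bilinear_lmul[OF bw] bilinear_rmul[OF bw])
  have sg: "g x y = g y x" for x y
  proof -
    have "g x y = h (swap_J Q (split_A x)) y" by (simp add: g_def w_def)
    also have "\<dots> = - h x (split_A (swap_J Q y))" by (simp add: hJ hA)
    also have "\<dots> = h x (swap_J Q (split_A y))" by (simp add: AJ bilinear_rneg[OF bh])
    also have "\<dots> = g y x" by (simp add: g_def w_def sh)
    finally show ?thesis .
  qed
  have ng: "nondegenerate g"
  proof -
    have "x = 0" if "\<forall>y. g x y = 0" for x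
      using that nw AA[of x] linear_0[OF lA] unfolding g_def nondegenerate_def by metis
    then show ?thesis unfolding nondegenerate_def using sg by metis
  qed
  have rA: "recursion_op g w = split_A"
    by (rule recursion_op_eqI[OF bg ng]) (auto simp: is_recursion_op_def lA bijA g_def AA)
  have lB: "linear (\<lambda>x. swap_J Q (split_A x))" using linear_compose[OF lA lJ] by (simp add: o_def)
  have BB: "swap_J Q (split_A (swap_J Q (split_A x))) = x" for x
    by (simp add: AJ linear_neg[OF lJ] JJ AA)
  have bijB: "bij (\<lambda>x. swap_J Q (split_A x))"
    by (rule o_bij[of "\<lambda>x. swap_J Q (split_A x)"]) (intro ext; simp add: BB)+
  have rB: "recursion_op g h = (\<lambda>x. swap_J Q (split_A x))"
    by (rule recursion_op_eqI[OF bg ng]) (auto simp: is_recursion_op_def lB bijB g_def w_def BB)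
  have lnJ: "linear (\<lambda>x. - swap_J Q x)" using lJ by (simp add: linear_compose_neg)
  have bijnJ: "bij (\<lambda>x. - swap_J Q x)"
    by (rule o_bij[of "swap_J Q"]) (intro ext; simp add: JJ linear_neg[OF lJ])+
  have rJ: "recursion_op w h = (\<lambda>x. - swap_J Q x)"
    by (rule recursion_op_eqI[OF bw nw])
      (auto simp: is_recursion_op_def lnJ bijnJ w_def JJ linear_neg[OF lJ])
  show "born_A (associated_born hp hm Q) = split_A" unfolding T by (simp add: rA)
  show "born_B (associated_born hp hm Q) = (\<lambda>x. swap_J Q (split_A x))" unfolding T by (simp add: rB)
  show "born_J (associated_born hp hm Q) = swap_J Q" unfolding T by (simp add: rJ)
  show "born_structure br (associated_born hp hm Q)" if "lie_algebra br"
  proof -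
    have "pseudo_metric g" "pseudo_metric h" "two_form w"
      unfolding pseudo_metric_def two_form_def using bg bh bw sg sh skw ng nh by blast+
    then show ?thesis
      unfolding T born_structure.simps born_A.simps born_B.simps born_J.simps rA rB rJ
      using that nw AA BB JJ by simp
  qed
qed

end

theory Submission
  imports Defs
begin

text \<open>
  The isometry \<open>Q\<close> identifies the two summands, and under this identification the representation
  \<open>\<rho>\<close> of \<open>\<gg>\<^sub>+\<close> on \<open>\<gg>\<^sub>-\<close> becomes a left-invariant connection \<open>D\<^sup>+\<close> on \<open>\<gg>\<^sub>+\<close>; in the same way
  \<open>\<phi>\<close> becomes a connection \<open>D\<^sup>-\<close> on \<open>\<gg>\<^sub>-\<close>. The summands are subalgebras of a bicross product
  by construction, so integrability means \<open>N\<^sub>J = 0\<close> and \<open>d\<omega> = 0\<close>, and each of these is a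
  statement about torsion:

  \<^item> \<open>N\<^sub>J = 0\<close> if and only if \<open>D\<^sup>+\<close> and \<open>D\<^sup>-\<close> are torsion-free (\<open>nijenhuis_vanishes_iff\<close>);
  \<^item> \<open>d\<omega> = 0\<close> if and only if their metric duals are torsion-free (\<open>closed_iff\<close>).

  A connection that is torsion-free together with its metric dual is a statistical structure.
  By \<open>statistical_structure_iff\<close> this says that the mean of the two connections, which is the
  skew part, is the Levi-Civita connection, and that their difference, which is twice the
  symmetric part, is symmetric in both arguments. For \<open>D\<^sup>-\<close> these are the first and
  the second condition of the theorem, for \<open>D\<^sup>+\<close> the third and the fourth, once the isometry has
  been moved past the adjoint (\<open>parts_conjugate\<close>).
\<close>

section \<open>Adjoints and statistical structures\<close>

definition torsion_free ::
  "('a::real_vector \<Rightarrow> 'a \<Rightarrow> 'a) \<Rightarrow> ('a \<Rightarrow> 'a \<Rightarrow> 'a) \<Rightarrow> bool" where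
  "torsion_free br D \<longleftrightarrow> (\<forall>x y. D x y - D y x = br x y)"

text \<open>
  The conjugate connection of information geometry: the pair of \<open>D\<close> and its dual \<open>D'\<close> leaves \<open>h\<close>
  parallel, in the sense that \<open>h (D x y) z + h y (D' x z) = 0\<close>.
\<close>

definition dual_connection ::
  "('a::real_vector \<Rightarrow> 'a \<Rightarrow> real) \<Rightarrow> ('a \<Rightarrow> 'a \<Rightarrow> 'a) \<Rightarrow> ('a \<Rightarrow> 'a \<Rightarrow> 'a)" where
  "dual_connection h D = (\<lambda>x y. - metric_adjoint h (D x) y)"

lemma pseudo_metricD:
  assumes "pseudo_metric h"
  shows "bilinear h" "nondegenerate h" "h x y = h y x"
  using assms unfolding pseudo_metric_def by auto

lemma lie_bracket_skew:
  assumes "lie_algebra br"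
  shows "br x y = - br y x"
proof -
  have b: "bilinear br" and alt: "\<And>x. br x x = 0"
    using assms unfolding lie_algebra_def by auto
  have "br x y + br y x = 0"
    using alt[of "x + y"] unfolding bilinear_ladd[OF b] bilinear_radd[OF b]
    by (simp add: alt add.commute)
  then show ?thesis by (simp add: eq_neg_iff_add_eq_0)
qed

lemma metric_adjoint_works:
  fixes h :: "'a::real_vector \<Rightarrow> 'a \<Rightarrow> real"
  assumes "finite_dimensional TYPE('a)" "pseudo_metric h" "linear f"
  shows "linear (metric_adjoint h f)" "h (f x) y = h x (metric_adjoint h f y)"
  using theI'[OF metric_adjoint_ex1[OF assms], folded metric_adjoint_def] by blast+

lemma metric_adjoint_eqI:
  fixes h :: "'a::real_vector \<Rightarrow> 'a \<Rightarrow> real"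
  assumes "finite_dimensional TYPE('a)" "pseudo_metric h" "linear f"
    and "linear f'" "\<And>x y. h (f x) y = h x (f' y)"
  shows "metric_adjoint h f = f'"
  unfolding metric_adjoint_def
  by (rule the1_equality[OF metric_adjoint_ex1[OF assms(1-3)]]) (use assms(4,5) in blast)

lemma levi_civita_eq_iff:
  assumes "lie_algebra br" "pseudo_metric h"
  shows "levi_civita br h = D \<longleftrightarrow> is_levi_civita br h D"
  using theI'[OF levi_civita_ex1[OF assms]] the1_equality[OF levi_civita_ex1[OF assms]]
  unfolding levi_civita_def by blast

lemma skew_part_skew:
  fixes h :: "'a::real_vector \<Rightarrow> 'a \<Rightarrow> real"
  assumes fd: "finite_dimensional TYPE('a)" and h: "pseudo_metric h" and f: "linear f"
  shows "h (skew_part h f x) y + h x (skew_part h f y) = 0"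
proof -
  note b = pseudo_metricD(1)[OF h]
  have "h (metric_adjoint h f x) y = h x (f y)"
    using metric_adjoint_works(2)[OF fd h f, of y x] pseudo_metricD(3)[OF h] by metis
  then show ?thesis
    unfolding skew_part_def
    by (simp add: bilinear_lmul[OF b] bilinear_rmul[OF b] bilinear_lsub[OF b] bilinear_rsub[OF b]
        metric_adjoint_works(2)[OF fd h f] field_simps)
qed

lemma bilinear_metric_adjoint:
  fixes h :: "'a::real_vector \<Rightarrow> 'a \<Rightarrow> real"
  assumes fd: "finite_dimensional TYPE('a)" and h: "pseudo_metric h" and D: "bilinear D"
  shows "bilinear (\<lambda>x. metric_adjoint h (D x))"
proof -
  note b = pseudo_metricD(1)[OF h]
  have lD: "linear (D x)" for x using D unfolding bilinear_def by blast
  note adj = metric_adjoint_works[OF fd h lD]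
  have adj': "h (metric_adjoint h (D x) y) z = h (D x z) y" for x y z
    using adj(2)[of x z y] pseudo_metricD(3)[OF h] by metis
  have "linear (\<lambda>x. metric_adjoint h (D x) y)" for y
    by (rule linearI; rule nondegenerate_eqI[OF b pseudo_metricD(2)[OF h]])
      (simp_all add: adj' bilinear_ladd[OF b] bilinear_lmul[OF b] bilinear_ladd[OF D]
        bilinear_lmul[OF D])
  with adj(1) show ?thesis unfolding bilinear_def by blast
qed

text \<open>
  The skew part of \<open>D x\<close> is the mean of \<open>D x\<close> and its dual, and the symmetric part is half their
  difference. The mean always preserves \<open>h\<close>, so it is the Levi-Civita connection as soon as it is
  torsion-free. Both torsions vanish if and only if their mean and their difference do: the mean is
  the torsion of the skew part, and half the difference is the failure of the symmetric part to be
  symmetric in its two arguments.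
\<close>

lemma statistical_structure_iff:
  fixes br :: "'a::real_vector \<Rightarrow> 'a \<Rightarrow> 'a"
  assumes L: "lie_algebra br" and h: "pseudo_metric h" and D: "bilinear D"
  shows "torsion_free br D \<and> torsion_free br (dual_connection h D) \<longleftrightarrow>
    (\<forall>x. skew_part h (D x) = levi_civita br h x) \<and>
    (\<forall>x y. sym_part h (D x) y = sym_part h (D y) x)"
proof -
  have fd: "finite_dimensional TYPE('a)" using L unfolding lie_algebra_def by blast
  have lD: "linear (D x)" for x using D unfolding bilinear_def by blast
  let ?S = "\<lambda>x. skew_part h (D x)"
  have "bilinear ?S"
    using D bilinear_metric_adjoint[OF fd h D] unfolding skew_part_def bilinear_def
    by (simp add: linear_compose_scale_right linear_compose_sub)
  then have "levi_civita br h = ?S \<longleftrightarrow> torsion_free br ?S"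
    unfolding levi_civita_eq_iff[OF L h] is_levi_civita_def torsion_free_def
    by (simp add: skew_part_skew[OF fd h lD])
  then have "(\<forall>x. ?S x = levi_civita br h x) \<longleftrightarrow> torsion_free br ?S"
    by (metis ext)
  moreover have "D x y - D y x = br x y \<and> dual_connection h D x y - dual_connection h D y x = br x y
      \<longleftrightarrow> ?S x y - ?S y x = br x y \<and> sym_part h (D x) y = sym_part h (D y) x" for x y
  proof -
    let ?t = "D x y - D y x" and ?t' = "dual_connection h D x y - dual_connection h D y x"
    have mean: "?S x y - ?S y x = (1/2) *\<^sub>R (?t + ?t')"
      by (simp add: skew_part_def dual_connection_def algebra_simps)
    have "sym_part h (D x) y - sym_part h (D y) x = (1/2) *\<^sub>R (?t - ?t')"
      by (simp add: sym_part_def dual_connection_def algebra_simps)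
    then have diff: "sym_part h (D x) y = sym_part h (D y) x \<longleftrightarrow> ?t = ?t'"
      by (metis right_minus_eq scaleR_eq_0_iff zero_neq_numeral divide_eq_0_iff zero_neq_one)
    have "(1/2) *\<^sub>R (t + t) = t" for t :: 'a by (simp flip: scaleR_2)
    then show ?thesis unfolding mean diff by metis
  qed
  ultimately show ?thesis unfolding torsion_free_def by metis
qed

text \<open>
  Pairing with an arbitrary vector moves the adjoint to the other side, which gives the
  adjoint-free form in which the torsion of the dual connection occurs in \<open>d\<omega>\<close>.
\<close>

lemma torsion_free_dual_connection_iff:
  fixes h :: "'a::real_vector \<Rightarrow> 'a \<Rightarrow> real"
  assumes fd: "finite_dimensional TYPE('a)" and h: "pseudo_metric h" and D: "bilinear D"
  shows "torsion_free br (dual_connection h D) \<longleftrightarrow>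
    (\<forall>x y z. h (br x y) z + h (D x z) y - h (D y z) x = 0)"
proof -
  note b = pseudo_metricD(1)[OF h]
  have lD: "linear (D x)" for x using D unfolding bilinear_def by blast
  have adj: "h (metric_adjoint h (D x) y) z = h (D x z) y" for x y z
    using metric_adjoint_works(2)[OF fd h lD, of x z y] pseudo_metricD(3)[OF h] by metis
  have eq: "u = v \<longleftrightarrow> (\<forall>z. h u z = h v z)" for u v
    using nondegenerate_eqI[OF b pseudo_metricD(2)[OF h]] by blast
  show ?thesis
    unfolding torsion_free_def dual_connection_def eq
    by (simp add: bilinear_lsub[OF b] bilinear_lneg[OF b] adj) (smt (verit))
qed

section \<open>Transport along an isometry\<close>

text \<open>
  Both directions of transport are needed: \<open>Q\<close> carries \<open>\<phi>\<close> to \<open>\<gg>\<^sub>-\<close> and its inverse carries \<open>\<rho>\<close> to \<open>\<gg>\<^sub>+\<close>.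
\<close>

lemma linear_isometry_inv:
  assumes "linear_isometry h k Q"
  shows "linear_isometry k h (inv Q)"
proof -
  have lQ: "linear Q" and bQ: "bij Q" and iQ: "\<And>x y. k (Q x) (Q y) = h x y"
    using assms unfolding linear_isometry_def by auto
  have QI: "Q (inv Q y) = y" "inv Q (Q x) = x" for x y
    using bQ by (simp_all add: bij_is_surj surj_f_inv_f bij_is_inj)
  have "linear (inv Q)"
    by (rule linearI) (metis QI linear_add[OF lQ], metis QI linear_scale[OF lQ])
  moreover have "bij (inv Q)" using bQ by (rule bij_imp_bij_inv)
  moreover have "h (inv Q x) (inv Q y) = k x y" for x y using iQ QI by metis
  ultimately show ?thesis unfolding linear_isometry_def by blast
qed

lemma metric_adjoint_conjugate:
  fixes h :: "'a::real_vector \<Rightarrow> 'a \<Rightarrow> real" and k :: "'b::real_vector \<Rightarrow> 'b \<Rightarrow> real"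
  assumes fda: "finite_dimensional TYPE('a)" and fdb: "finite_dimensional TYPE('b)"
    and h: "pseudo_metric h" and k: "pseudo_metric k"
    and Q: "linear_isometry h k Q" and f: "linear f"
  shows "metric_adjoint k (Q \<circ> f \<circ> inv Q) = Q \<circ> metric_adjoint h f \<circ> inv Q"
proof (rule metric_adjoint_eqI[OF fdb k])
  note I = linear_isometry_inv[OF Q]
  have lQ: "linear Q" "linear (inv Q)" and QI: "Q (inv Q y) = y" for y
    using Q I unfolding linear_isometry_def by (auto simp: bij_is_surj surj_f_inv_f)
  have iQ: "k (Q x) y = h x (inv Q y)" "k y (Q x) = h (inv Q y) x" for x y
    using Q QI unfolding linear_isometry_def by metis+
  note adj = metric_adjoint_works[OF fda h f]
  show "linear (Q \<circ> f \<circ> inv Q)" "linear (Q \<circ> metric_adjoint h f \<circ> inv Q)"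
    using lQ f adj(1) by (auto intro!: linear_compose)
  show "k ((Q \<circ> f \<circ> inv Q) x) y = k x ((Q \<circ> metric_adjoint h f \<circ> inv Q) y)" for x y
    by (simp add: iQ adj(2))
qed

lemma parts_conjugate:
  fixes h :: "'a::real_vector \<Rightarrow> 'a \<Rightarrow> real" and k :: "'b::real_vector \<Rightarrow> 'b \<Rightarrow> real"
  assumes "finite_dimensional TYPE('a)" "finite_dimensional TYPE('b)"
    and "pseudo_metric h" "pseudo_metric k" and Q: "linear_isometry h k Q" and "linear f"
  shows "skew_part k (Q \<circ> f \<circ> inv Q) = Q \<circ> skew_part h f \<circ> inv Q"
    and "sym_part k (Q \<circ> f \<circ> inv Q) = Q \<circ> sym_part h f \<circ> inv Q"
proof -
  have lQ: "linear Q" using Q unfolding linear_isometry_def by blast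
  show "skew_part k (Q \<circ> f \<circ> inv Q) = Q \<circ> skew_part h f \<circ> inv Q"
    and "sym_part k (Q \<circ> f \<circ> inv Q) = Q \<circ> sym_part h f \<circ> inv Q"
    unfolding skew_part_def sym_part_def metric_adjoint_conjugate[OF assms]
    by (auto simp: linear_add[OF lQ] linear_diff[OF lQ] linear_scale[OF lQ])
qed

section \<open>Integrability of the associated Born structure\<close>

text \<open>
  The isometry turns \<open>\<phi>\<close> and \<open>\<rho>\<close>, which act on the opposite summand, into connections on
  \<open>\<gg>\<^sub>-\<close> and \<open>\<gg>\<^sub>+\<close>.
\<close>

locale bicross_isometry =
  fixes brp :: "'p::real_vector \<Rightarrow> 'p \<Rightarrow> 'p"
    and brm :: "'m::real_vector \<Rightarrow> 'm \<Rightarrow> 'm"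
    and hp :: "'p \<Rightarrow> 'p \<Rightarrow> real"
    and hm :: "'m \<Rightarrow> 'm \<Rightarrow> real"
    and Q :: "'p \<Rightarrow> 'm"
    and \<phi> :: "'m \<Rightarrow> 'p \<Rightarrow> 'p"
    and \<rho> :: "'p \<Rightarrow> 'm \<Rightarrow> 'm"
  assumes Lp: "lie_algebra brp" and Lm: "lie_algebra brm"
    and hp: "pseudo_metric hp" and hm: "pseudo_metric hm"
    and Q: "linear_isometry hp hm Q"
    and phi: "bilinear \<phi>" and rho: "bilinear \<rho>"
begin

definition conn_m :: "'m \<Rightarrow> 'm \<Rightarrow> 'm" where "conn_m a = Q \<circ> \<phi> a \<circ> inv Q"
definition conn_p :: "'p \<Rightarrow> 'p \<Rightarrow> 'p" where "conn_p x = inv Q \<circ> \<rho> x \<circ> Q"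

lemma fd_p: "finite_dimensional TYPE('p)" and fd_m: "finite_dimensional TYPE('m)"
  and brp: "bilinear brp" and brm: "bilinear brm"
  using Lp Lm unfolding lie_algebra_def by auto

lemma Q_inv [simp]: "Q (inv Q a) = a" "inv Q (Q x) = x"
  using Q unfolding linear_isometry_def by (auto simp: bij_is_surj surj_f_inv_f bij_is_inj)

lemma linear_Q: "linear Q" and linear_invQ: "linear (inv Q)"
  using Q linear_isometry_inv[OF Q] unfolding linear_isometry_def by auto

lemma inv_inv_Q: "inv (inv Q) = Q"
  using Q unfolding linear_isometry_def by (simp add: inv_inv_eq)

lemma hm_Q: "hm (Q x) a = hp x (inv Q a)" "hm a (Q x) = hp (inv Q a) x"
  using Q Q_inv unfolding linear_isometry_def by metis+

lemmas lin = linear_add[OF linear_Q] linear_diff[OF linear_Q] linear_neg[OF linear_Q]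
  linear_0[OF linear_Q] linear_scale[OF linear_Q]
  linear_add[OF linear_invQ] linear_diff[OF linear_invQ] linear_neg[OF linear_invQ]
  linear_0[OF linear_invQ] linear_scale[OF linear_invQ]

lemmas bil_zero = bilinear_lzero[OF brp] bilinear_rzero[OF brp] bilinear_lzero[OF brm]
  bilinear_rzero[OF brm] bilinear_lzero[OF phi] bilinear_rzero[OF phi]
  bilinear_lzero[OF rho] bilinear_rzero[OF rho]
  bilinear_lzero[OF pseudo_metricD(1)[OF hp]] bilinear_rzero[OF pseudo_metricD(1)[OF hp]]
  bilinear_lzero[OF pseudo_metricD(1)[OF hm]] bilinear_rzero[OF pseudo_metricD(1)[OF hm]]

lemmas bil_neg = bilinear_lneg[OF phi] bilinear_rneg[OF phi] bilinear_lneg[OF rho]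
  bilinear_rneg[OF rho] bilinear_lneg[OF brp] bilinear_rneg[OF brp]
  bilinear_lneg[OF brm] bilinear_rneg[OF brm]

lemmas metric_bil =
  bilinear_ladd[OF pseudo_metricD(1)[OF hp]] bilinear_radd[OF pseudo_metricD(1)[OF hp]]
  bilinear_lsub[OF pseudo_metricD(1)[OF hp]] bilinear_rsub[OF pseudo_metricD(1)[OF hp]]
  bilinear_lneg[OF pseudo_metricD(1)[OF hp]] bilinear_rneg[OF pseudo_metricD(1)[OF hp]]
  bilinear_ladd[OF pseudo_metricD(1)[OF hm]] bilinear_radd[OF pseudo_metricD(1)[OF hm]]
  bilinear_lsub[OF pseudo_metricD(1)[OF hm]] bilinear_rsub[OF pseudo_metricD(1)[OF hm]]
  bilinear_lneg[OF pseudo_metricD(1)[OF hm]] bilinear_rneg[OF pseudo_metricD(1)[OF hm]]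

lemma bilinear_conn: "bilinear conn_m" "bilinear conn_p"
proof -
  show "bilinear conn_m"
    unfolding bilinear_def conn_m_def by (intro conjI allI; rule linearI)
      (simp_all add: lin bilinear_ladd[OF phi] bilinear_radd[OF phi] bilinear_lmul[OF phi]
        bilinear_rmul[OF phi])
  show "bilinear conn_p"
    unfolding bilinear_def conn_p_def by (intro conjI allI; rule linearI)
      (simp_all add: lin bilinear_ladd[OF rho] bilinear_radd[OF rho] bilinear_lmul[OF rho]
        bilinear_rmul[OF rho])
qed

text \<open>
  On vectors \<open>x, y\<close> of \<open>\<gg>\<^sub>+\<close> the component of \<open>N\<^sub>J(x, y)\<close> in \<open>\<gg>\<^sub>+\<close> is the torsion of \<open>conn_p\<close>, and the
  component in \<open>\<gg>\<^sub>-\<close> is, up to sign, the torsion of \<open>conn_m\<close> on \<open>Q x, Q y\<close>. These values determine \<open>N\<^sub>J\<close>,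
  because \<open>N\<^sub>J(J X, Y) = - J N\<^sub>J(X, Y)\<close> and \<open>J\<close> interchanges the summands.
\<close>

lemma nijenhuis_vanishes_iff:
  "(\<forall>X Y. nijenhuis (bicross_bracket brp brm \<phi> \<rho>) (swap_J Q) X Y = 0) \<longleftrightarrow>
    torsion_free brm conn_m \<and> torsion_free brp conn_p"
proof
  assume N: "\<forall>X Y. nijenhuis (bicross_bracket brp brm \<phi> \<rho>) (swap_J Q) X Y = 0"
  have "conn_p x y - conn_p y x = brp x y \<and>
      conn_m (Q x) (Q y) - conn_m (Q y) (Q x) = brm (Q x) (Q y)" for x y
    using N[rule_format, of "(x, 0)" "(y, 0)"]
    by (simp add: nijenhuis_def conn_p_def conn_m_def bil_zero lin zero_prod_def algebra_simps)
  then show "torsion_free brm conn_m \<and> torsion_free brp conn_p"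
    unfolding torsion_free_def by (metis Q_inv(1))
next
  assume T: "torsion_free brm conn_m \<and> torsion_free brp conn_p"
  have e: "brm a b = conn_m a b - conn_m b a" "brp x y = conn_p x y - conn_p y x" for a b x y
    using T unfolding torsion_free_def by auto
  show "\<forall>X Y. nijenhuis (bicross_bracket brp brm \<phi> \<rho>) (swap_J Q) X Y = 0"
    by (auto simp: nijenhuis_def e conn_p_def conn_m_def lin bil_neg zero_prod_def algebra_simps)
qed

text \<open>
  Each summand is isotropic for \<open>\<omega>\<close> and a subalgebra, so \<open>d\<omega>\<close> vanishes on three vectors of the same
  summand. What remains is \<open>d\<omega>\<close> on two vectors of one summand and one of the other. There the
  bracket inside the summand contributes the bracket term of the torsion of the dual connection, and
  the two mixed brackets, which \<open>\<omega>\<close> sees only through the representation on the opposite summand,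
  contribute the two terms with the adjoint.
\<close>

lemma closed_iff:
  "(\<forall>X Y Z. ce_differential (bicross_bracket brp brm \<phi> \<rho>)
      (\<lambda>X Y. sum_form hp hm (swap_J Q X) Y) X Y Z = 0) \<longleftrightarrow>
    torsion_free brm (dual_connection hm conn_m) \<and> torsion_free brp (dual_connection hp conn_p)"
    (is "(\<forall>X Y Z. ?d X Y Z = 0) \<longleftrightarrow> _")
proof -
  \<comment> \<open>Up to sign, the torsions of the dual connections, paired with a third vector.\<close>
  define Tm where "Tm a b c = hm (brm a b) c + hm (conn_m a c) b - hm (conn_m b c) a" for a b c
  define Tp where "Tp x y z = hp (brp x y) z + hp (conn_p x z) y - hp (conn_p y z) x" for x y z
  have d: "?d (x, a) (y, b) (z, c) =
      Tm a b (Q z) + Tm b c (Q x) + Tm c a (Q y)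
      - (Tp x y (inv Q c) + Tp y z (inv Q a) + Tp z x (inv Q b))" for x y z a b c
  proof -
    have "brp z x = - brp x z" "brm c a = - brm a c"
      using Lp Lm by (blast intro: lie_bracket_skew)+
    then show ?thesis
      by (simp add: ce_differential_def Tm_def Tp_def conn_p_def conn_m_def hm_Q lin metric_bil)
  qed
  have "(\<forall>X Y Z. ?d X Y Z = 0) \<longleftrightarrow> (\<forall>a b c. Tm a b c = 0) \<and> (\<forall>x y z. Tp x y z = 0)"
  proof
    assume *: "\<forall>X Y Z. ?d X Y Z = 0"
    have "Tm a b (Q z) = 0" for a b z
      using *[rule_format, of "(0, a)" "(0, b)" "(z, 0)"] unfolding d
      by (simp add: Tm_def Tp_def conn_m_def conn_p_def bil_zero lin)
    moreover have "Tp x y (inv Q c) = 0" for x y c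
      using *[rule_format, of "(x, 0)" "(y, 0)" "(0, c)"] unfolding d
      by (simp add: Tm_def Tp_def conn_m_def conn_p_def bil_zero lin)
    ultimately show "(\<forall>a b c. Tm a b c = 0) \<and> (\<forall>x y z. Tp x y z = 0)"
      by (metis Q_inv)
  qed (simp add: d split_paired_all)
  then show ?thesis
    unfolding Tm_def Tp_def torsion_free_dual_connection_iff[OF fd_p hp bilinear_conn(2)]
      torsion_free_dual_connection_iff[OF fd_m hm bilinear_conn(1)] .
qed

lemma subalgebras:
  "lie_subalgebra (bicross_bracket brp brm \<phi> \<rho>) {X. split_A X = X}"
  "lie_subalgebra (bicross_bracket brp brm \<phi> \<rho>) {X. split_A X = - X}"
proof -
  have neg: "v = - v \<longleftrightarrow> v = 0" "- v = v \<longleftrightarrow> v = 0" for v :: "'v::real_vector"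
    by (metis eq_neg_iff_add_eq_0 scaleR_2 scaleR_eq_0_iff zero_neq_numeral)+
  show "lie_subalgebra (bicross_bracket brp brm \<phi> \<rho>) {X. split_A X = X}"
    "lie_subalgebra (bicross_bracket brp brm \<phi> \<rho>) {X. split_A X = - X}"
    unfolding lie_subalgebra_def subspace_def
    by (auto simp: zero_prod_def bil_zero neg)
qed

end

theorem theorem3p7:
  fixes brp :: "'p::real_vector \<Rightarrow> 'p \<Rightarrow> 'p"
    and brm :: "'m::real_vector \<Rightarrow> 'm \<Rightarrow> 'm"
    and hp :: "'p \<Rightarrow> 'p \<Rightarrow> real"
    and hm :: "'m \<Rightarrow> 'm \<Rightarrow> real"
    and Q :: "'p \<Rightarrow> 'm"
    and \<phi> :: "'m \<Rightarrow> 'p \<Rightarrow> 'p"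
    and \<rho> :: "'p \<Rightarrow> 'm \<Rightarrow> 'm"
  assumes "lie_algebra brp" and "lie_algebra brm"
    and "dim (UNIV :: 'p set) = dim (UNIV :: 'm set)"
    and "pseudo_metric hp" and "pseudo_metric hm"
    and "signature hp = signature hm"
    and "linear_isometry hp hm Q"
    and "lie_representation brm \<phi>" and "lie_representation brp \<rho>"
    and "bicross_compatible brp brm \<phi> \<rho>"
  shows "integrable_born (bicross_bracket brp brm \<phi> \<rho>) (associated_born hp hm Q) \<longleftrightarrow>
     (\<forall>Xm. skew_part hp (\<phi> Xm) = inv Q \<circ> levi_civita brm hm Xm \<circ> Q) \<and>
     (\<forall>Xp Yp. sym_part hp (\<phi> (Q Xp)) Yp = sym_part hp (\<phi> (Q Yp)) Xp) \<and>
     (\<forall>Xp. skew_part hm (\<rho> Xp) = Q \<circ> levi_civita brp hp Xp \<circ> inv Q) \<and>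
     (\<forall>Xp Yp. sym_part hm (\<rho> Xp) (Q Yp) = sym_part hm (\<rho> Yp) (Q Xp))"
proof -
  interpret bicross_isometry brp brm hp hm Q \<phi> \<rho>
    using assms by unfold_locales (auto simp: lie_representation_def)
  let ?br = "bicross_bracket brp brm \<phi> \<rho>"
  define w where "w = (\<lambda>X Y. sum_form hp hm (swap_J Q X) Y)"
  have lin_phi: "linear (\<phi> a)" and lin_rho: "linear (\<rho> x)" for a x
    using phi rho unfolding bilinear_def by auto
  have T: "associated_born hp hm Q = (\<lambda>X. w (split_A X), sum_form hp hm, w)"
    by (simp add: associated_born_def born_of_encoding_def w_def Let_def)
  note ops = associated_born_ops[OF hp hm Q, unfolded T]
  have "integrable_born ?br (associated_born hp hm Q) \<longleftrightarrow>
      (\<forall>X Y Z. ce_differential ?br w X Y Z = 0) \<and> (\<forall>X Y. nijenhuis ?br (swap_J Q) X Y = 0)"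
    unfolding T integrable_born.simps ops(1,3)
    using ops(4)[OF lie_algebra_bicross[OF assms(1,2,8-10)]] subalgebras by blast
  also have "\<dots> \<longleftrightarrow>
      (torsion_free brm conn_m \<and> torsion_free brm (dual_connection hm conn_m)) \<and>
      (torsion_free brp conn_p \<and> torsion_free brp (dual_connection hp conn_p))"
    unfolding w_def closed_iff nijenhuis_vanishes_iff by blast
  also have "\<dots> \<longleftrightarrow>
      ((\<forall>a. skew_part hm (conn_m a) = levi_civita brm hm a) \<and>
       (\<forall>a b. sym_part hm (conn_m a) b = sym_part hm (conn_m b) a)) \<and>
      ((\<forall>x. skew_part hp (conn_p x) = levi_civita brp hp x) \<and>
       (\<forall>x y. sym_part hp (conn_p x) y = sym_part hp (conn_p y) x))"
    unfolding statistical_structure_iff[OF Lm hm bilinear_conn(1)]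
      statistical_structure_iff[OF Lp hp bilinear_conn(2)] ..
  also have "(\<forall>a. skew_part hm (conn_m a) = levi_civita brm hm a) \<longleftrightarrow>
      (\<forall>a. skew_part hp (\<phi> a) = inv Q \<circ> levi_civita brm hm a \<circ> Q)"
    unfolding conn_m_def parts_conjugate[OF fd_p fd_m hp hm Q lin_phi]
    by (simp add: fun_eq_iff) (metis Q_inv)
  also have "(\<forall>a b. sym_part hm (conn_m a) b = sym_part hm (conn_m b) a) \<longleftrightarrow>
      (\<forall>x y. sym_part hp (\<phi> (Q x)) y = sym_part hp (\<phi> (Q y)) x)"
    unfolding conn_m_def parts_conjugate[OF fd_p fd_m hp hm Q lin_phi]
    by simp (metis Q_inv)
  also have "(\<forall>x. skew_part hp (conn_p x) = levi_civita brp hp x) \<longleftrightarrow>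
      (\<forall>x. skew_part hm (\<rho> x) = Q \<circ> levi_civita brp hp x \<circ> inv Q)"
    unfolding conn_p_def
      parts_conjugate[OF fd_m fd_p hm hp linear_isometry_inv[OF Q] lin_rho, unfolded inv_inv_Q]
    by (simp add: fun_eq_iff) (metis Q_inv)
  also have "(\<forall>x y. sym_part hp (conn_p x) y = sym_part hp (conn_p y) x) \<longleftrightarrow>
      (\<forall>x y. sym_part hm (\<rho> x) (Q y) = sym_part hm (\<rho> y) (Q x))"
    unfolding conn_p_def
      parts_conjugate[OF fd_m fd_p hm hp linear_isometry_inv[OF Q] lin_rho, unfolded inv_inv_Q]
    by simp (metis Q_inv)
  finally show ?thesis by (simp only: conj_assoc)
qed

end
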